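(* Let $G$ and $H$ be graphs and let $\mathcal F$ be a family of graphs each of which is S-prime with respect to the Cartesian product. Then $$\iota(G\,\square\, H,\mathcal F)\le \beta_{\mathcal F}^{\rm dom}(G)\,\beta_{\mathcal F}^{\rm dom}(H).$$
   Context: All graphs are finite, simple and undirected. "Subgraph" means not necessarily induced subgraph. The Cartesian product $G\,\square\, H$ has vertex set $V(G)\times V(H)$, and $(g,h)$, $(g',h')$ are adjacent if and only if either $g=g'$ and $hh'\in E(H)$, or $h=h'$ and $gg'\in E(G)$. A graph $X$ is S-prime with respect to the Cartesian product if, for all graphs $G$ and $H$, whenever $X$ is isomorphic to a subgraph of $G\,\square\, H$, $X$ is isomorphic to a subgraph of $G$ or of $H$. A set $S\subseteq V(G)$ is an $\mathcal F$-isolating set of $G$ if the subgraph induced by $V(G)-N_G[S]$ contains no subgraph isomorphic to a member of $\mathcal F$, where $N_G[S]$ is the closed neighborhood of $S$; $\iota(G,\mathcal F)$ is the minimum cardinality of an $\mathcal F$-isolating set of $G$. An $\mathcal F$-transversal of $G$ is a set $T\subseteq V(G)$ that intersects the vertex set of every subgraph of $G$ isomorphic to a member of $\mathcal F$. A dominating $\mathcal F$-transversal is an $\mathcal F$-transversal that is also a dominating set of $G$ (every vertex outside it has a neighbor in it); $\beta_{\mathcal F}^{\rm dom}(G)$ is the minimum cardinality of a dominating $\mathcal F$-transversal of $G$. *)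

theory Defs
  imports
    "Graph_Theory.Pair_Digraph"
    "Graph_Theory.Digraph_Isomorphism"
    "HOL-Library.Extended_Nat"
begin

(* A finite simple undirected graph is a pair_graph: a finite loop-free digraph without
   parallel arcs whose arc relation is symmetric.  The edge uv is the pair of arcs (u,v), (v,u).
   As in Graph_Theory, the null graph is not excluded. *)

definition cart_prod ::
    "'a pair_pre_digraph \<Rightarrow> 'b pair_pre_digraph \<Rightarrow> ('a \<times> 'b) pair_pre_digraph"
    (infixl \<open>\<box>\<close> 70) where
  "G \<box> H = \<lparr> pverts = pverts G \<times> pverts H,
     parcs = {((g, h), (g', h')). g = g' \<and> g \<in> pverts G \<and> (h, h') \<in> parcs H \<or>
                                 h = h' \<and> h \<in> pverts H \<and> (g, g') \<in> parcs G} \<rparr>"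

(* The host is a pre_digraph so that it can be an induced subgraph as provided by the library.
   Requiring pair_graph K makes subgraph mean subgraph of undirected graphs:
   with every arc, K contains the reverse arc. *)
definition subgraph_copy ::
    "'c pair_pre_digraph \<Rightarrow> 'a pair_pre_digraph \<Rightarrow> ('a, 'a \<times> 'a) pre_digraph \<Rightarrow> bool" where
  "subgraph_copy X K G \<longleftrightarrow>
     pair_graph K \<and> subgraph (with_proj K) G \<and> digraph_iso (with_proj X) (with_proj K)"

definition contains_copy ::
    "('a, 'a \<times> 'a) pre_digraph \<Rightarrow> 'c pair_pre_digraph \<Rightarrow> bool" where
  "contains_copy G X \<longleftrightarrow> (\<exists>K. subgraph_copy X K G)"

(* Graphs on natural numbers represent all finite graphs up to isomorphism;
   S_primeD below gives the property for factors with arbitrary vertex types. *)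
definition S_prime :: "'c pair_pre_digraph \<Rightarrow> bool" where
  "S_prime X \<longleftrightarrow>
     (\<forall>(G :: nat pair_pre_digraph) (H :: nat pair_pre_digraph).
        pair_graph G \<longrightarrow> pair_graph H \<longrightarrow> contains_copy (with_proj (G \<box> H)) X \<longrightarrow>
        contains_copy (with_proj G) X \<or> contains_copy (with_proj H) X)"

definition closed_nbhd :: "'a pair_pre_digraph \<Rightarrow> 'a set \<Rightarrow> 'a set" where
  "closed_nbhd G S = S \<union> {v. \<exists>u\<in>S. (u, v) \<in> parcs G}"

definition isolating_set ::
    "'a pair_pre_digraph \<Rightarrow> 'c pair_pre_digraph set \<Rightarrow> 'a set \<Rightarrow> bool" where
  "isolating_set G F S \<longleftrightarrow> S \<subseteq> pverts G \<and>
     \<not> (\<exists>X\<in>F. contains_copy (with_proj G \<restriction> (pverts G - closed_nbhd G S)) X)"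

(* A minimum over no sets at all is infinite.  This happens only if F contains the null graph;
   see isolation_number_attained and dom_transversal_number_attained. *)
definition isolation_number ::
    "'a pair_pre_digraph \<Rightarrow> 'c pair_pre_digraph set \<Rightarrow> enat" where
  "isolation_number G F = (INF S\<in>{S. isolating_set G F S}. enat (card S))"

definition transversal ::
    "'a pair_pre_digraph \<Rightarrow> 'c pair_pre_digraph set \<Rightarrow> 'a set \<Rightarrow> bool" where
  "transversal G F T \<longleftrightarrow> T \<subseteq> pverts G \<and>
     (\<forall>X\<in>F. \<forall>K. subgraph_copy X K (with_proj G) \<longrightarrow> T \<inter> pverts K \<noteq> {})"

definition dominating_set :: "'a pair_pre_digraph \<Rightarrow> 'a set \<Rightarrow> bool" where
  "dominating_set G T \<longleftrightarrow> T \<subseteq> pverts G \<and> (\<forall>v\<in>pverts G - T. \<exists>u\<in>T. (v, u) \<in> parcs G)"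

definition dom_transversal_number ::
    "'a pair_pre_digraph \<Rightarrow> 'c pair_pre_digraph set \<Rightarrow> enat" where
  "dom_transversal_number G F =
     (INF T\<in>{T. transversal G F T \<and> dominating_set G T}. enat (card T))"


lemma INF_card_attained:
  assumes "P (A :: 'a set)"
  shows "\<exists>S. P S \<and> (INF S\<in>{S. P S}. enat (card S)) = enat (card S)"
proof -
  have "(INF S\<in>{S. P S}. enat (card S)) \<in> (\<lambda>S. enat (card S)) ` {S. P S}"
    using assms by (intro wellorder_InfI) auto
  then show ?thesis by auto
qed

lemma subgraph_copy_nonnull:
  assumes "subgraph_copy X K G" "pverts X \<noteq> {}"
  shows "pverts K \<noteq> {}"
  using assms
  by (auto simp: subgraph_copy_def digraph_iso_def app_iso_def with_proj_def)

lemma subgraph_copy_verts: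
  "subgraph_copy X K G \<Longrightarrow> pverts K \<subseteq> verts G"
  by (auto simp: subgraph_copy_def subgraph_def)

lemma isolation_number_attained:
  assumes "\<forall>X\<in>F. pverts X \<noteq> {}"
  shows "\<exists>S. isolating_set G F S \<and> isolation_number G F = enat (card S)"
proof -
  have "isolating_set G F (pverts G)"
    using assms subgraph_copy_nonnull subgraph_copy_verts
    by (fastforce simp: isolating_set_def contains_copy_def closed_nbhd_def)
  then show ?thesis
    unfolding isolation_number_def by (rule INF_card_attained)
qed

lemma dom_transversal_number_attained:
  assumes "\<forall>X\<in>F. pverts X \<noteq> {}"
  shows "\<exists>T. transversal G F T \<and> dominating_set G T \<and>
             dom_transversal_number G F = enat (card T)"
proof -
  have "transversal G F (pverts G) \<and> dominating_set G (pverts G)"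
    using assms subgraph_copy_nonnull subgraph_copy_verts
    by (fastforce simp: transversal_def dominating_set_def)
  then show ?thesis
    unfolding dom_transversal_number_def
    using INF_card_attained[of "\<lambda>T. transversal G F T \<and> dominating_set G T"] by auto
qed

lemma pair_graph_iff:
  "pair_graph G \<longleftrightarrow> finite (pverts G) \<and> parcs G \<subseteq> pverts G \<times> pverts G \<and> sym (parcs G) \<and>
     irrefl (parcs G)"
proof
  assume "pair_graph G"
  then interpret pair_graph G .
  show "finite (pverts G) \<and> parcs G \<subseteq> pverts G \<times> pverts G \<and> sym (parcs G) \<and> irrefl (parcs G)"
    using in_arcsD1 in_arcsD2 arcs_symmetric no_loops' pair_finite_verts
    unfolding sym_def irrefl_def by fast
next
  assume *: "finite (pverts G) \<and> parcs G \<subseteq> pverts G \<times> pverts G \<and> sym (parcs G) \<and>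
     irrefl (parcs G)"
  then have "finite (parcs G)" by (meson finite_SigmaI finite_subset)
  with * show "pair_graph G"
    by unfold_locales (auto simp: symmetric_def irrefl_def)
qed

lemma pair_graph_cart_prod:
  assumes "pair_graph G" "pair_graph H"
  shows "pair_graph (G \<box> H)"
  using assms by (auto simp: pair_graph_iff cart_prod_def sym_def irrefl_def)

lemma contains_copy_iff:
  assumes "pair_graph X" "pair_graph G"
  shows "contains_copy (with_proj G) X \<longleftrightarrow>
    (\<exists>f. inj_on f (pverts X) \<and> f ` pverts X \<subseteq> pverts G \<and>
         (\<forall>u v. (u, v) \<in> parcs X \<longrightarrow> (f u, f v) \<in> parcs G))"
    (is "?L \<longleftrightarrow> ?R")
proof
  assume ?L
  then obtain K h where K: "subgraph (with_proj K) (with_proj G)"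
    and h: "pre_digraph.digraph_isomorphism (with_proj X) h"
      "with_proj K = app_iso h (with_proj X)"
    by (auto simp: contains_copy_def subgraph_copy_def digraph_iso_def)
  have "inj_on (iso_verts h) (pverts X)"
    using h by (simp add: pre_digraph.digraph_isomorphism_def)
  moreover have "iso_verts h ` pverts X \<subseteq> pverts G"
    using K h(2) by (simp add: subgraph_def)
  moreover have "(iso_verts h u, iso_verts h v) \<in> parcs G" if "(u, v) \<in> parcs X" for u v
  proof -
    have t: "iso_tail h = fst" "iso_head h = snd"
      using h(2) by (auto simp: app_iso_def with_proj_def)
    have "iso_arcs h (u, v) = (iso_verts h u, iso_verts h v)"
      using h(1) that by (force simp: pre_digraph.digraph_isomorphism_def t prod_eq_iff)
    moreover have "iso_arcs h (u, v) \<in> parcs K"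
      using h(2) that by (auto simp: app_iso_def with_proj_def)
    ultimately show ?thesis using K by (auto simp: subgraph_def)
  qed
  ultimately show ?R by blast
next
  assume ?R
  then obtain f where f: "inj_on f (pverts X)" "f ` pverts X \<subseteq> pverts G"
    "\<And>u v. (u, v) \<in> parcs X \<Longrightarrow> (f u, f v) \<in> parcs G" by blast
  define K where "K = \<lparr> pverts = f ` pverts X, parcs = map_prod f f ` parcs X \<rparr>"
  define h where "h = \<lparr> iso_verts = f, iso_arcs = map_prod f f, iso_head = snd, iso_tail = fst \<rparr>"
  have arcsX: "parcs X \<subseteq> pverts X \<times> pverts X" using assms(1) by (simp add: pair_graph_iff)
  have sub: "pverts K \<subseteq> pverts G" "parcs K \<subseteq> parcs G"
    using f by (auto simp: K_def)
  have wfK: "parcs K \<subseteq> pverts K \<times> pverts K" using arcsX by (auto simp: K_def)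
  have "sym (parcs K)"
    using assms(1) by (fastforce simp: K_def pair_graph_iff sym_def)
  then have pK: "pair_graph K"
    using assms(2) sub wfK by (auto simp: pair_graph_iff irrefl_def intro: finite_subset)
  interpret G: pair_graph G by fact
  interpret K: pair_graph K by fact
  interpret X: pair_graph X by fact
  have "subgraph (with_proj K) (with_proj G)"
    using sub by (auto simp: subgraph_def compatible_def intro: G.wf_digraph K.wf_digraph)
  moreover have "pre_digraph.digraph_isomorphism (with_proj X) h"
    using f(1) arcsX X.wf_digraph
    by (auto simp: pre_digraph.digraph_isomorphism_def h_def
        intro!: inj_on_subset[OF map_prod_inj_on[OF f(1) f(1)]])
  moreover have "with_proj K = app_iso h (with_proj X)"
    by (simp add: app_iso_def with_proj_def h_def K_def)
  ultimately show ?L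
    using pK by (auto simp: contains_copy_def subgraph_copy_def digraph_iso_def)
qed

lemma nat_copy:
  assumes "pair_graph (G :: 'a pair_pre_digraph)"
  obtains N :: "nat pair_pre_digraph" and f where "pair_graph N"
    "inj_on f (pverts G)" "pverts N = f ` pverts G" "parcs N = map_prod f f ` parcs G"
proof -
  obtain f :: "'a \<Rightarrow> nat" where f: "inj_on f (pverts G)"
    using assms finite_imp_inj_to_nat_seg[of "pverts G"] by (auto simp: pair_graph_iff)
  define N where "N = \<lparr> pverts = f ` pverts G, parcs = map_prod f f ` parcs G \<rparr>"
  have "irrefl (parcs N)"
    using assms f by (fastforce simp: N_def pair_graph_iff irrefl_def inj_on_def)
  moreover have "sym (parcs N)"
    using assms by (fastforce simp: N_def pair_graph_iff sym_def)
  ultimately have "pair_graph N"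
    using assms by (auto simp: N_def pair_graph_iff)
  with f that show thesis by (simp add: N_def)
qed

lemma contains_copy_transfer:
  assumes "pair_graph X" "pair_graph G" "pair_graph G'" "contains_copy (with_proj G) X"
    and "inj_on f (pverts G)" "f ` pverts G \<subseteq> pverts G'"
    and "\<And>u v. (u, v) \<in> parcs G \<Longrightarrow> (f u, f v) \<in> parcs G'"
  shows "contains_copy (with_proj G') X"
proof -
  obtain e where "inj_on e (pverts X)" "e ` pverts X \<subseteq> pverts G"
    "\<And>u v. (u, v) \<in> parcs X \<Longrightarrow> (e u, e v) \<in> parcs G"
    using assms by (auto simp: contains_copy_iff)
  then have "inj_on (f \<circ> e) (pverts X) \<and> (f \<circ> e) ` pverts X \<subseteq> pverts G' \<and>
     (\<forall>u v. (u, v) \<in> parcs X \<longrightarrow> ((f \<circ> e) u, (f \<circ> e) v) \<in> parcs G')"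
    using assms(5-7) by (auto simp: image_subset_iff intro!: comp_inj_on intro: inj_on_subset)
  then show ?thesis using assms by (auto simp only: contains_copy_iff)
qed

lemma contains_copy_back:
  assumes "pair_graph X" "pair_graph A" "pair_graph B" "contains_copy (with_proj B) X"
    and g: "inj_on g (pverts A)" "pverts B = g ` pverts A" "parcs B = map_prod g g ` parcs A"
  shows "contains_copy (with_proj A) X"
proof (rule contains_copy_transfer[where f = "the_inv_into (pverts A) g"])
  show "inj_on (the_inv_into (pverts A) g) (pverts B)"
    using g by (simp add: inj_on_the_inv_into)
  show "the_inv_into (pverts A) g ` pverts B \<subseteq> pverts A"
    using g by (auto simp: the_inv_into_f_f)
  show "(the_inv_into (pverts A) g u, the_inv_into (pverts A) g v) \<in> parcs A"
    if uv: "(u, v) \<in> parcs B" for u v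
  proof -
    obtain a b where ab: "(a, b) \<in> parcs A" "u = g a" "v = g b"
      using uv g(3) by auto
    moreover have "a \<in> pverts A" "b \<in> pverts A"
      using ab(1) assms(2) by (auto simp: pair_graph_iff)
    ultimately show ?thesis
      using g(1) by (simp add: the_inv_into_f_f)
  qed
qed (use assms in auto)

lemma S_primeD:
  assumes "pair_graph X" "S_prime X" "pair_graph G" "pair_graph H"
    and "contains_copy (with_proj (G \<box> H)) X"
  shows "contains_copy (with_proj G) X \<or> contains_copy (with_proj H) X"
proof -
  obtain M and f :: "_ \<Rightarrow> nat" where M: "pair_graph M" "inj_on f (pverts G)" "pverts M = f ` pverts G"
    "parcs M = map_prod f f ` parcs G" using nat_copy[OF assms(3)] by metis
  obtain N and k :: "_ \<Rightarrow> nat" where N: "pair_graph N" "inj_on k (pverts H)" "pverts N = k ` pverts H"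
    "parcs N = map_prod k k ` parcs H" using nat_copy[OF assms(4)] by metis
  have "contains_copy (with_proj (M \<box> N)) X"
  proof (rule contains_copy_transfer[where f = "map_prod f k"])
    show "contains_copy (with_proj (G \<box> H)) X" by fact
    show "inj_on (map_prod f k) (pverts (G \<box> H))"
      using M N by (simp add: cart_prod_def map_prod_inj_on)
    show "map_prod f k ` pverts (G \<box> H) \<subseteq> pverts (M \<box> N)"
      using M N by (auto simp: cart_prod_def)
    show "(map_prod f k u, map_prod f k v) \<in> parcs (M \<box> N)" if "(u, v) \<in> parcs (G \<box> H)" for u v
      using that M N by (auto simp: cart_prod_def)
  qed (use assms M N in \<open>auto intro: pair_graph_cart_prod\<close>)
  then have "contains_copy (with_proj M) X \<or> contains_copy (with_proj N) X"
    using assms(2) M N unfolding S_prime_def by blast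
  then show ?thesis
    using contains_copy_back[OF assms(1,3) M(1) _ M(2-4)]
      contains_copy_back[OF assms(1,4) N(1) _ N(2-4)] by blast
qed

end

theory Submission
  imports Defs
begin

text \<open>
  Take dominating \<open>F\<close>-transversals \<open>A\<close> of \<open>G\<close> and \<open>B\<close> of \<open>H\<close> of minimum cardinality.  The set
  \<open>A \<times> B\<close> is \<open>F\<close>-isolating in \<open>G \<box> H\<close>.  Indeed, since \<open>B\<close> dominates \<open>H\<close>, each fibre \<open>{a} \<times> H\<close>
  with \<open>a \<in> A\<close> lies in the closed neighbourhood of \<open>A \<times> B\<close>, and symmetrically for the fibres
  \<open>G \<times> {b}\<close> with \<open>b \<in> B\<close> (\<open>closed_nbhd_Times_dominating\<close>).  So both coordinates of every vertex
  left over avoid the chosen sets, and what remains is a subgraph of \<open>(G - A) \<box> (H - B)\<close>.  If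
  it contained a copy of some \<open>X \<in> F\<close>, then S-primality would put a copy of \<open>X\<close> in \<open>G - A\<close> or
  in \<open>H - B\<close>, against the choice of \<open>A\<close> and \<open>B\<close> as transversals.

  Minimum sets exist unless \<open>F\<close> contains the null graph, of which every graph contains a copy
  that no set meets.  In that case neither factor has an \<open>F\<close>-transversal, both numbers on the
  right are infinite, and so is their product.
\<close>

text \<open>
  Counterpart on \<^typ>\<open>'a pair_pre_digraph\<close> of the library's induced subgraph, so that
  induced subgraphs can serve as factors of a Cartesian product.
\<close>

definition pair_induce :: "'a pair_pre_digraph \<Rightarrow> 'a set \<Rightarrow> 'a pair_pre_digraph" where
  "pair_induce G V = \<lparr> pverts = V, parcs = parcs G \<inter> V \<times> V \<rparr>"

lemma with_proj_pair_induce: "with_proj G \<restriction> V = with_proj (pair_induce G V)"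
  by (auto simp: induce_subgraph_def pair_induce_def with_proj_def)

lemma pair_graph_pair_induce:
  assumes "pair_graph G" "V \<subseteq> pverts G"
  shows "pair_graph (pair_induce G V)"
  using assms
  by (auto simp: pair_graph_iff pair_induce_def sym_def irrefl_def intro: finite_subset)

lemma subgraph_copy_pair_induceD:
  assumes "pair_graph G" "V \<subseteq> pverts G" "subgraph_copy X K (with_proj (pair_induce G V))"
  shows "subgraph_copy X K (with_proj G)" "pverts K \<subseteq> V"
proof -
  interpret pair_graph G by fact
  have "subgraph (with_proj (pair_induce G V)) (with_proj G)"
    using assms(2) subgraph_induce_subgraphI by (simp flip: with_proj_pair_induce)
  then show "subgraph_copy X K (with_proj G)"
    using assms(3) unfolding subgraph_copy_def by (blast intro: subgraph_trans)
  show "pverts K \<subseteq> V"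
    using subgraph_copy_verts[OF assms(3)] by (simp add: pair_induce_def)
qed

lemma transversal_imp_no_copy:
  assumes "pair_graph G" "transversal G F T" "X \<in> F"
  shows "\<not> contains_copy (with_proj (pair_induce G (pverts G - T))) X"
proof
  assume "contains_copy (with_proj (pair_induce G (pverts G - T))) X"
  then obtain K where "subgraph_copy X K (with_proj (pair_induce G (pverts G - T)))"
    by (auto simp: contains_copy_def)
  from subgraph_copy_pair_induceD[OF assms(1) _ this]
  have "subgraph_copy X K (with_proj G)" "T \<inter> pverts K = {}" by auto
  then show False
    using assms(2,3) unfolding transversal_def by blast
qed

text \<open>A copy of the null graph has no vertex that a transversal could meet.\<close>

lemma dom_transversal_number_null_graph:
  assumes "pair_graph G" "X \<in> F" "pair_graph X" "pverts X = {}"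
  shows "dom_transversal_number G F = \<infinity>"
proof -
  have "contains_copy (with_proj (pair_induce G (pverts G - T))) X" for T
    using assms(1,3,4)
    by (subst contains_copy_iff) (auto intro: pair_graph_pair_induce simp: pair_graph_iff[of X])
  then have "\<not> transversal G F T" for T
    using transversal_imp_no_copy assms(1,2) by blast
  then show ?thesis
    by (simp add: dom_transversal_number_def top_enat_def)
qed

text \<open>
  For \<open>(g, h)\<close> with \<open>g \<in> A\<close>, either \<open>h \<in> B\<close> or \<open>h\<close> has a neighbour \<open>b \<in> B\<close>, and then \<open>(g, b)\<close>
  is a neighbour of \<open>(g, h)\<close> in \<open>A \<times> B\<close>; likewise with the factors exchanged.
\<close>

lemma closed_nbhd_Times_dominating:
  assumes G: "pair_graph G" and H: "pair_graph H"
    and A: "dominating_set G A" and B: "dominating_set H B"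
  shows "pverts (G \<box> H) - closed_nbhd (G \<box> H) (A \<times> B) \<subseteq> (pverts G - A) \<times> (pverts H - B)"
proof -
  have "(g, h) \<in> closed_nbhd (G \<box> H) (A \<times> B)" if gh: "g \<in> A" "h \<in> pverts H" for g h
  proof (cases "h \<in> B")
    case False
    then obtain b where "b \<in> B" "(b, h) \<in> parcs H"
      using False B H gh(2) unfolding dominating_set_def pair_graph_iff sym_def by blast
    then show ?thesis
      using A gh(1) by (force simp: closed_nbhd_def cart_prod_def dominating_set_def)
  qed (use gh in \<open>simp add: closed_nbhd_def\<close>)
  moreover have "(g, h) \<in> closed_nbhd (G \<box> H) (A \<times> B)" if gh: "g \<in> pverts G" "h \<in> B" for g h
  proof (cases "g \<in> A")
    case False
    then obtain a where "a \<in> A" "(a, g) \<in> parcs G"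
      using False A G gh(1) unfolding dominating_set_def pair_graph_iff sym_def by blast
    then show ?thesis
      using B gh(2) by (force simp: closed_nbhd_def cart_prod_def dominating_set_def)
  qed (use gh in \<open>simp add: closed_nbhd_def\<close>)
  ultimately show ?thesis by (auto simp: cart_prod_def)
qed

lemma isolating_set_Times:
  assumes G: "pair_graph G" and H: "pair_graph H"
    and F: "\<And>X. X \<in> F \<Longrightarrow> pair_graph X" "\<And>X. X \<in> F \<Longrightarrow> S_prime X"
    and A: "transversal G F A" "dominating_set G A"
    and B: "transversal H F B" "dominating_set H B"
  shows "isolating_set (G \<box> H) F (A \<times> B)"
proof -
  define R where "R = pverts (G \<box> H) - closed_nbhd (G \<box> H) (A \<times> B)"
  define G' where "G' = pair_induce G (pverts G - A)"
  define H' where "H' = pair_induce H (pverts H - B)"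
  have G': "pair_graph G'" and H': "pair_graph H'"
    using G H by (simp_all add: G'_def H'_def pair_graph_pair_induce)
  have R: "pair_graph (pair_induce (G \<box> H) R)"
    using G H by (simp add: R_def pair_graph_pair_induce pair_graph_cart_prod)
  have R_sub: "R \<subseteq> (pverts G - A) \<times> (pverts H - B)"
    unfolding R_def using closed_nbhd_Times_dominating[OF G H A(2) B(2)] .
  have "\<not> contains_copy (with_proj (pair_induce (G \<box> H) R)) X" if X: "X \<in> F" for X
  proof
    assume copy: "contains_copy (with_proj (pair_induce (G \<box> H) R)) X"
    have "contains_copy (with_proj (G' \<box> H')) X"
    proof (rule contains_copy_transfer[OF F(1)[OF X] R _ copy, where f = id])
      show "pair_graph (G' \<box> H')" using G' H' by (rule pair_graph_cart_prod)
      show "id ` pverts (pair_induce (G \<box> H) R) \<subseteq> pverts (G' \<box> H')"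
        using R_sub by (simp add: G'_def H'_def pair_induce_def cart_prod_def)
      show "(id u, id v) \<in> parcs (G' \<box> H')" if "(u, v) \<in> parcs (pair_induce (G \<box> H) R)" for u v
        using that R_sub by (auto simp: G'_def H'_def pair_induce_def cart_prod_def)
    qed simp
    then have "contains_copy (with_proj G') X \<or> contains_copy (with_proj H') X"
      using S_primeD F X G' H' by blast
    then show False
      using transversal_imp_no_copy[OF G A(1) X] transversal_imp_no_copy[OF H B(1) X]
      by (simp add: G'_def H'_def)
  qed
  moreover have "A \<times> B \<subseteq> pverts (G \<box> H)"
    using A(2) B(2) by (auto simp: dominating_set_def cart_prod_def)
  ultimately show ?thesis
    by (auto simp: isolating_set_def with_proj_pair_induce simp flip: R_def)
qed

theorem theorem6p3:
  fixes G :: "'a pair_pre_digraph" and H :: "'b pair_pre_digraph"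
    and F :: "'c pair_pre_digraph set"
  assumes "pair_graph G" and "pair_graph H"
    and "\<And>X. X \<in> F \<Longrightarrow> pair_graph X"
    and "\<And>X. X \<in> F \<Longrightarrow> S_prime X"
  shows "isolation_number (G \<box> H) F \<le> dom_transversal_number G F * dom_transversal_number H F"
proof (cases "\<forall>X\<in>F. pverts X \<noteq> {}")
  case True
  obtain A where A: "transversal G F A" "dominating_set G A"
      "dom_transversal_number G F = enat (card A)"
    using dom_transversal_number_attained[OF True] by blast
  obtain B where B: "transversal H F B" "dominating_set H B"
      "dom_transversal_number H F = enat (card B)"
    using dom_transversal_number_attained[OF True] by blast
  have "isolating_set (G \<box> H) F (A \<times> B)"
    using assms A B by (intro isolating_set_Times)
  then have "isolation_number (G \<box> H) F \<le> enat (card (A \<times> B))"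
    unfolding isolation_number_def by (intro INF_lower) simp
  also have "\<dots> = dom_transversal_number G F * dom_transversal_number H F"
    using A(3) B(3) by (simp add: card_cartesian_product)
  finally show ?thesis .
next
  case False
  then obtain X where "X \<in> F" "pverts X = {}" by blast
  then have "dom_transversal_number G F = \<infinity>" "dom_transversal_number H F = \<infinity>"
    using assms(1-3) by (auto intro: dom_transversal_number_null_graph)
  then show ?thesis by simp
qed

end
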